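(* Let $A\in\mathfrak{H}_{V,1}$ be any $V$-variable fractal set and let $\epsilon>0$. Then $A$ is a finite union of continuous transformations of at most $V$ distinct compact subsets of $\mathbb{X}$, and the diameter of each of these transformed sets is at most $\epsilon$. (That is, there are compact sets $K_1,\dots,K_V\subset\mathbb{X}$, finitely many continuous maps $g_1,\dots,g_r:\mathbb{X}\to\mathbb{X}$ and indices $v(1),\dots,v(r)\in\{1,\dots,V\}$ such that $A=\bigcup_{j=1}^r g_j(K_{v(j)})$ and $\operatorname{diam} g_j(K_{v(j)})\le\epsilon$ for all $j$.)
   Context: SuperIFS. $(\mathbb{X},d)$ is a compact metric space; $M,N,V$ are positive integers. For $n\in\{1,\dots,N\}$, $m\in\{1,\dots,M\}$, $f_m^n:\mathbb{X}\to\mathbb{X}$ is Lipschitz with constant $l$, where $0\le l<1$ is fixed. $\mathbb{H}=\mathbb{H}(\mathbb{X})$ is the set of non-empty compact subsets of $\mathbb{X}$ with the Hausdorff metric, and $\mathbb{H}^V$ carries the maximum metric. $\mathcal{A}=\{\{1,\dots,N\}\times\{1,\dots,V\}^M\}^V$; write $a=(a_1,\dots,a_V)\in\mathcal{A}$ with $a_v=(n_v;v_{v,1},\dots,v_{v,M})$. For $a\in\mathcal{A}$ define $f^a:\mathbb{H}^V\to\mathbb{H}^V$ by letting the $v$-th component of $f^a(K_1,\dots,K_V)$ be $\bigcup_{m=1}^M f_m^{n_v}(K_{v_{v,m}})$; each $f^a$ is a contraction. $\mathfrak{H}_V\subset\mathbb{H}^V$ is the set attractor of the IFS $\{\mathbb{H}^V;f^a,a\in\mathcal{A}\}$,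 i.e. the unique non-empty compact subset of $\mathbb{H}^V$ with $\mathfrak{H}_V=\bigcup_{a\in\mathcal{A}}f^a(\mathfrak{H}_V)$. $\mathfrak{H}_{V,1}\subset\mathbb{H}$ is the set of first components of elements of $\mathfrak{H}_V$; its elements are called $V$-variable fractal sets. *)

theory Defs
  imports "HOL-Analysis.Analysis"
begin

definition nonempty_compacts :: "'a::metric_space set \<Rightarrow> 'a set set" where
  "nonempty_compacts X = {K. K \<noteq> {} \<and> compact K \<and> K \<subseteq> X}"

text \<open>The guard keeps the suprema meaningful; the library's \<open>Metric_space\<close> locale requires a
  distance to be nonnegative and symmetric also outside the carrier.\<close>

definition hausdorff_dist :: "'a::metric_space set \<Rightarrow> 'a set \<Rightarrow> real" where
  "hausdorff_dist A B =
     (if A \<noteq> {} \<and> bounded A \<and> B \<noteq> {} \<and> bounded B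
      then max (SUP a\<in>A. infdist a B) (SUP b\<in>B. infdist b A) else 0)"

text \<open>A \<open>V\<close>-tuple is an extensional function on \<open>{1..V}\<close>.\<close>

definition compact_tuples :: "nat \<Rightarrow> 'a::metric_space set \<Rightarrow> (nat \<Rightarrow> 'a set) set" where
  "compact_tuples V X = {1..V} \<rightarrow>\<^sub>E nonempty_compacts X"

definition max_dist :: "nat \<Rightarrow> (nat \<Rightarrow> 'a::metric_space set) \<Rightarrow> (nat \<Rightarrow> 'a set) \<Rightarrow> real" where
  "max_dist V K L = (MAX v\<in>{1..V}. hausdorff_dist (K v) (L v))"

text \<open>An index \<open>a\<close> assigns to each \<open>v\<close> the pair \<open>a v = (n\<^sub>v, \<lambda>m. v\<^sub>v\<^sub>,\<^sub>m)\<close>.\<close>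

definition superifs_indices :: "nat \<Rightarrow> nat \<Rightarrow> nat \<Rightarrow> (nat \<Rightarrow> nat \<times> (nat \<Rightarrow> nat)) set" where
  "superifs_indices M N V = {1..V} \<rightarrow>\<^sub>E ({1..N} \<times> ({1..M} \<rightarrow>\<^sub>E {1..V}))"

text \<open>The map with lower index \<open>m\<close> and upper index \<open>n\<close> is written \<open>f n m\<close>.\<close>

definition superifs_map ::
  "nat \<Rightarrow> nat \<Rightarrow> (nat \<Rightarrow> nat \<Rightarrow> 'a \<Rightarrow> 'a) \<Rightarrow> (nat \<Rightarrow> nat \<times> (nat \<Rightarrow> nat))
     \<Rightarrow> (nat \<Rightarrow> 'a set) \<Rightarrow> (nat \<Rightarrow> 'a set)" where
  "superifs_map M V f a K =
     (\<lambda>v\<in>{1..V}. \<Union>m\<in>{1..M}. f (fst (a v)) m ` K (snd (a v) m))"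

text \<open>Set attractor of the IFS \<open>{Y; h a, a \<in> I}\<close> on the metric space \<open>(Y, d)\<close>.\<close>

definition is_set_attractor ::
  "'y set \<Rightarrow> ('y \<Rightarrow> 'y \<Rightarrow> real) \<Rightarrow> 'i set \<Rightarrow> ('i \<Rightarrow> 'y \<Rightarrow> 'y) \<Rightarrow> 'y set \<Rightarrow> bool" where
  "is_set_attractor Y d I h S \<longleftrightarrow>
     S \<noteq> {} \<and> compactin (Metric_space.mtopology Y d) S \<and> S = (\<Union>a\<in>I. h a ` S)"

lemma bdd_infdist:
  assumes "bounded A" "B \<noteq> {}"
  shows "bdd_above ((\<lambda>a. infdist a B) ` A)"
proof -
  obtain b where b: "b \<in> B" using assms by auto
  obtain e where "\<forall>a\<in>A. dist b a \<le> e" using assms(1) bounded_any_center[of A b] by auto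
  then show ?thesis using b by (intro bdd_aboveI2[of _ _ e]) (metis dist_commute infdist_le2)
qed

lemma hausdorff_dist_le_iff:
  assumes "A \<in> nonempty_compacts X" "B \<in> nonempty_compacts X"
  shows "hausdorff_dist A B \<le> e \<longleftrightarrow> (\<forall>a\<in>A. infdist a B \<le> e) \<and> (\<forall>b\<in>B. infdist b A \<le> e)"
  using assms bdd_infdist[of A B] bdd_infdist[of B A]
  by (auto simp: hausdorff_dist_def nonempty_compacts_def compact_imp_bounded cSUP_le_iff)

lemma hausdorff_dist_nonneg: "0 \<le> hausdorff_dist A B"
proof (cases "A \<noteq> {} \<and> bounded A \<and> B \<noteq> {} \<and> bounded B")
  case True
  then obtain a where a: "a \<in> A" by auto
  have "0 \<le> infdist a B" by (rule infdist_nonneg)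
  also have "\<dots> \<le> (SUP a\<in>A. infdist a B)"
    using a True by (intro cSUP_upper bdd_infdist) auto
  finally show ?thesis using True by (simp add: hausdorff_dist_def)
qed (auto simp: hausdorff_dist_def)

lemma hausdorff_dist_commute: "hausdorff_dist A B = hausdorff_dist B A"
  by (auto simp: hausdorff_dist_def max.commute)

lemma infdist_triangle_set:
  assumes "compact B" "B \<noteq> {}" "\<And>b. b \<in> B \<Longrightarrow> infdist b C \<le> e"
  shows "infdist a C \<le> infdist a B + e"
proof -
  obtain b where b: "b \<in> B" "\<forall>y\<in>B. dist a b \<le> dist a y"
    using continuous_attains_inf[OF assms(1,2), of "dist a"] continuous_on_dist[OF continuous_on_const continuous_on_id]
    by auto
  have "dist a b \<le> infdist a B"
    using b assms(2) by (auto simp: infdist_def intro!: cINF_greatest)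
  have "infdist a C \<le> infdist b C + dist a b" by (rule infdist_triangle)
  with \<open>dist a b \<le> infdist a B\<close> show ?thesis using b(1) assms(3)[of b] by simp
qed

lemma Metric_space_hausdorff: "Metric_space (nonempty_compacts X) hausdorff_dist"
proof
  fix A B :: "'a set"
  show "0 \<le> hausdorff_dist A B" by (rule hausdorff_dist_nonneg)
  show "hausdorff_dist A B = hausdorff_dist B A" by (rule hausdorff_dist_commute)
next
  fix A B :: "'a set"
  assume AB: "A \<in> nonempty_compacts X" "B \<in> nonempty_compacts X"
  then have cl: "closed A" "closed B" "A \<noteq> {}" "B \<noteq> {}"
    by (auto simp: nonempty_compacts_def compact_imp_closed)
  have "hausdorff_dist A B = 0 \<longleftrightarrow> hausdorff_dist A B \<le> 0"
    using hausdorff_dist_nonneg[of A B] by linarith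
  also have "\<dots> \<longleftrightarrow> (\<forall>a\<in>A. infdist a B = 0) \<and> (\<forall>b\<in>B. infdist b A = 0)"
    unfolding hausdorff_dist_le_iff[OF AB] by (simp add: order_antisym_conv infdist_nonneg)
  also have "\<dots> \<longleftrightarrow> A = B"
    using cl in_closed_iff_infdist_zero by blast
  finally show "hausdorff_dist A B = 0 \<longleftrightarrow> A = B" .
next
  fix A B C :: "'a set"
  assume A: "A \<in> nonempty_compacts X" and B: "B \<in> nonempty_compacts X"
    and C: "C \<in> nonempty_compacts X"
  have cB: "compact B" "B \<noteq> {}" using B by (auto simp: nonempty_compacts_def)
  have 1: "\<forall>a\<in>A. infdist a B \<le> hausdorff_dist A B" "\<forall>b\<in>B. infdist b A \<le> hausdorff_dist A B"
    using hausdorff_dist_le_iff[OF A B] by auto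
  have 2: "\<forall>a\<in>B. infdist a C \<le> hausdorff_dist B C" "\<forall>b\<in>C. infdist b B \<le> hausdorff_dist B C"
    using hausdorff_dist_le_iff[OF B C] by auto
  show "hausdorff_dist A C \<le> hausdorff_dist A B + hausdorff_dist B C"
    unfolding hausdorff_dist_le_iff[OF A C]
  proof (intro conjI ballI)
    fix a assume "a \<in> A"
    then show "infdist a C \<le> hausdorff_dist A B + hausdorff_dist B C"
      using infdist_triangle_set[OF cB, of C "hausdorff_dist B C" a] 1 2 by fastforce
  next
    fix c assume "c \<in> C"
    then show "infdist c A \<le> hausdorff_dist A B + hausdorff_dist B C"
      using infdist_triangle_set[OF cB, of A "hausdorff_dist A B" c] 1 2 by fastforce
  qed
qed

lemma Metric_space_max_dist:
  assumes "V \<ge> 1"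
  shows "Metric_space (compact_tuples V X) (max_dist V)"
proof -
  interpret H: Metric_space "nonempty_compacts X" hausdorff_dist
    by (rule Metric_space_hausdorff)
  have le_iff: "max_dist V K L \<le> e \<longleftrightarrow> (\<forall>v\<in>{1..V}. hausdorff_dist (K v) (L v) \<le> e)"
    for K L :: "nat \<Rightarrow> 'a set" and e
    using assms unfolding max_dist_def by (subst Max_le_iff) auto
  have ge: "hausdorff_dist (K v) (L v) \<le> max_dist V K L" if "v \<in> {1..V}"
    for K L :: "nat \<Rightarrow> 'a set" and v
    using le_iff that by blast
  have nonneg: "0 \<le> max_dist V K L" for K L :: "nat \<Rightarrow> 'a set"
    using order_trans[OF hausdorff_dist_nonneg ge[of 1 K L]] assms by auto
  show ?thesis
  proof
    fix K L :: "nat \<Rightarrow> 'a set"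
    show "0 \<le> max_dist V K L" by (rule nonneg)
    show "max_dist V K L = max_dist V L K"
      unfolding max_dist_def by (simp only: hausdorff_dist_commute)
  next
    fix K L :: "nat \<Rightarrow> 'a set"
    assume KL: "K \<in> compact_tuples V X" "L \<in> compact_tuples V X"
    then have mem: "K v \<in> nonempty_compacts X" "L v \<in> nonempty_compacts X" if "v \<in> {1..V}" for v
      using that by (auto simp: compact_tuples_def)
    have "max_dist V K L = 0 \<longleftrightarrow> max_dist V K L \<le> 0" using nonneg[of K L] by linarith
    also have "\<dots> \<longleftrightarrow> (\<forall>v\<in>{1..V}. K v = L v)"
      unfolding le_iff using mem H.zero by (simp add: order_antisym_conv hausdorff_dist_nonneg)
    also have "\<dots> \<longleftrightarrow> K = L"
      using KL unfolding compact_tuples_def by (metis PiE_ext)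
    finally show "max_dist V K L = 0 \<longleftrightarrow> K = L" .
  next
    fix J K L :: "nat \<Rightarrow> 'a set"
    assume "J \<in> compact_tuples V X" "K \<in> compact_tuples V X" "L \<in> compact_tuples V X"
    then have "hausdorff_dist (J v) (L v) \<le> hausdorff_dist (J v) (K v) + hausdorff_dist (K v) (L v)"
      if "v \<in> {1..V}" for v
      using that by (intro H.triangle) (auto simp: compact_tuples_def)
    then show "max_dist V J L \<le> max_dist V J K + max_dist V K L"
      unfolding le_iff using ge[of _ J K] ge[of _ K L] by fastforce
  qed
qed

end

theory Submission
  imports Defs
begin

text \<open>Unfold the fixed-point equation of the attractor \<open>k\<close> times: every component of a point
  of the attractor is a finite union of images of components of another point of the attractor
  under \<open>k\<close>-fold compositions of the \<open>f n m\<close>. These are \<open>l ^ k\<close>-Lipschitz, so for large \<open>k\<close>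
  the images have diameter at most \<open>\<epsilon>\<close>.\<close>

lemma diameter_lipschitz_image_le:
  fixes g :: "'a::metric_space \<Rightarrow> 'b::metric_space"
  assumes "L-lipschitz_on X g" "bounded X" "K \<subseteq> X"
  shows "diameter (g ` K) \<le> L * diameter X"
proof -
  have L: "0 \<le> L" using assms(1) by (rule lipschitz_on_nonneg)
  have *: "dist x y \<le> L * diameter X" if "x \<in> g ` K" "y \<in> g ` K" for x y
  proof -
    obtain x' y' where xy: "x' \<in> X" "y' \<in> X" "x = g x'" "y = g y'"
      using \<open>x \<in> g ` K\<close> \<open>y \<in> g ` K\<close> assms(3) by auto
    then have "dist x y \<le> L * dist x' y'"
      using lipschitz_onD[OF assms(1)] by simp
    also have "\<dots> \<le> L * diameter X"
      using L xy diameter_bounded_bound[OF assms(2)] by (intro mult_left_mono) auto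
    finally show ?thesis .
  qed
  show ?thesis
  \<comment> \<open>The supremum bound needs a nonempty image. The empty set has diameter 0 by
    convention, so there it remains to see that the right-hand side is nonnegative.\<close>
  proof (cases "K = {}")
    case True
    then show ?thesis using L diameter_ge_0[OF assms(2)] by simp
  next
    case False
    then show ?thesis
      unfolding diameter_def[of "g ` K"] by (auto intro!: cSUP_least *)
  qed
qed

text \<open>Induction on \<open>k\<close>. A single tuple \<open>K\<close> has to serve all
  \<open>v\<close> at once: one component of \<open>H\<close> draws on several components of its
  predecessor, and their decompositions can only be merged if they refer to the same
  \<open>K\<close>. This is also why at most \<open>V\<close> sets get transformed, however large
  \<open>k\<close> is. Each pair \<open>(g, w)\<close> records one piece of the union.\<close>

lemma superifs_iterated_decomposition:
  assumes f: "\<And>n m. n \<in> {1..N} \<Longrightarrow> m \<in> {1..M} \<Longrightarrow> f n m \<in> X \<rightarrow> X"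
    and lip: "\<And>n m. n \<in> {1..N} \<Longrightarrow> m \<in> {1..M} \<Longrightarrow> l-lipschitz_on X (f n m)"
    and S: "S \<subseteq> (\<Union>a\<in>superifs_indices M N V. superifs_map M V f a ` S)"
    and H: "H \<in> S"
  shows "\<exists>K\<in>S. \<forall>v\<in>{1..V}. \<exists>P. finite P \<and>
           (\<forall>(g, w)\<in>P. g \<in> X \<rightarrow> X \<and> (l ^ k)-lipschitz_on X g \<and> w \<in> {1..V}) \<and>
           H v = (\<Union>(g, w)\<in>P. g ` K w)"
  using H
proof (induction k arbitrary: H)
  case 0
  show ?case
  proof (intro bexI[OF _ 0] ballI)
    \<comment> \<open>No unfolding: \<open>K\<close> is \<open>H\<close> itself, and the identity is
      the only map, with constant \<open>l ^ 0 = 1\<close>.\<close>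
    fix v assume "v \<in> {1..V}"
    then show "\<exists>P. finite P \<and>
           (\<forall>(g, w)\<in>P. g \<in> X \<rightarrow> X \<and> (l ^ 0)-lipschitz_on X g \<and> w \<in> {1..V}) \<and>
           H v = (\<Union>(g, w)\<in>P. g ` H w)"
      by (intro exI[of _ "{(\<lambda>x. x, v)}"]) (auto intro: lipschitz_intros)
  qed
next
  case (Suc k)
  \<comment> \<open>Peel off the outermost map. The predecessor \<open>H'\<close> differs from
    \<open>H\<close> in general, so the induction hypothesis is used with \<open>H\<close>
    generalised.\<close>
  obtain a H' where a: "a \<in> superifs_indices M N V" and H': "H' \<in> S"
    and H: "H = superifs_map M V f a H'"
    using Suc.prems S by auto
  obtain K where K: "K \<in> S" and ex: "\<forall>v\<in>{1..V}. \<exists>P. finite P \<and>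
           (\<forall>(g, w)\<in>P. g \<in> X \<rightarrow> X \<and> (l ^ k)-lipschitz_on X g \<and> w \<in> {1..V}) \<and>
           H' v = (\<Union>(g, w)\<in>P. g ` K w)"
    using Suc.IH[OF H'] by blast
  \<comment> \<open>Choose decompositions for all components of \<open>H'\<close> simultaneously,
    since component \<open>v\<close> of \<open>H\<close> involves \<open>H' (u m)\<close> for every
    \<open>m\<close>.\<close>
  obtain P where P: "\<forall>v\<in>{1..V}. finite (P v) \<and>
           (\<forall>(g, w)\<in>P v. g \<in> X \<rightarrow> X \<and> (l ^ k)-lipschitz_on X g \<and> w \<in> {1..V}) \<and>
           H' v = (\<Union>(g, w)\<in>P v. g ` K w)"
    using bchoice[OF ex] by (rule exE)
  show ?case
  proof (intro bexI[OF _ K] ballI)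
    fix v assume v: "v \<in> {1..V}"
    define n where "n = fst (a v)"
    define u where "u = snd (a v)"
    have "a v \<in> {1..N} \<times> ({1..M} \<rightarrow>\<^sub>E {1..V})"
      using a v unfolding superifs_indices_def by (rule PiE_mem)
    then have n: "n \<in> {1..N}" and u: "u m \<in> {1..V}" if "m \<in> {1..M}" for m
      using that by (auto simp: n_def u_def mem_Times_iff dest: PiE_mem)
    \<comment> \<open>The new map goes on the outside of each old composition, while the index
      \<open>w\<close> into \<open>K\<close> is unchanged.\<close>
    define Q where "Q = (\<Union>m\<in>{1..M}. (\<lambda>(g, w). (f n m \<circ> g, w)) ` P (u m))"
    have "finite Q"
      unfolding Q_def using P u by (intro finite_UN_I finite_imageI) auto
    moreover have "g \<in> X \<rightarrow> X \<and> (l ^ Suc k)-lipschitz_on X g \<and> w \<in> {1..V}" if gw: "(g, w) \<in> Q" for g w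
    proof -
      obtain m g' where m: "m \<in> {1..M}" and g': "(g', w) \<in> P (u m)" "g = f n m \<circ> g'"
        using gw by (auto simp: Q_def)
      have *: "g' \<in> X \<rightarrow> X" "(l ^ k)-lipschitz_on X g'" "w \<in> {1..V}"
        using P[rule_format, OF u[OF m]] g'(1) by auto
      \<comment> \<open>Since \<open>g'\<close> maps \<open>X\<close> into itself, the constants
        multiply to \<open>l * l ^ k\<close>.\<close>
      have "l-lipschitz_on (g' ` X) (f n m)"
        using *(1) by (intro lipschitz_on_subset[OF lip[OF n[OF m] m]]) auto
      then have "(l ^ Suc k)-lipschitz_on X g"
        using lipschitz_on_compose[OF *(2)] g'(2) by simp
      then show ?thesis
        using * f[OF n[OF m] m] g'(2) by auto
    qed
    moreover have "H v = (\<Union>(g, w)\<in>Q. g ` K w)"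
    proof -
      have "H v = (\<Union>m\<in>{1..M}. f n m ` H' (u m))"
        using v by (simp add: H superifs_map_def n_def u_def)
      also have "\<dots> = (\<Union>m\<in>{1..M}. f n m ` (\<Union>(g, w)\<in>P (u m). g ` K w))"
        using P u by (intro SUP_cong refl arg_cong[where f = "image _"]) blast
      also have "\<dots> = (\<Union>(g, w)\<in>Q. g ` K w)"
        by (simp add: Q_def image_UN image_comp split_def) blast
      finally show ?thesis .
    qed
    ultimately show "\<exists>P. finite P \<and>
           (\<forall>(g, w)\<in>P. g \<in> X \<rightarrow> X \<and> (l ^ Suc k)-lipschitz_on X g \<and> w \<in> {1..V}) \<and>
           H v = (\<Union>(g, w)\<in>P. g ` K w)"
      by blast
  qed
qed

theorem theorem18:
  fixes X :: "'a::metric_space set"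
    and M N V :: nat
    and f :: "nat \<Rightarrow> nat \<Rightarrow> 'a \<Rightarrow> 'a"
    and l \<epsilon> :: real
    and HV :: "(nat \<Rightarrow> 'a set) set"
    and A :: "'a set"
  assumes "compact X"
    and "M \<ge> 1" and "N \<ge> 1" and "V \<ge> 1"
    and "0 \<le> l" and "l < 1"
    and "\<And>n m. n \<in> {1..N} \<Longrightarrow> m \<in> {1..M} \<Longrightarrow> f n m \<in> X \<rightarrow> X"
    and "\<And>n m. n \<in> {1..N} \<Longrightarrow> m \<in> {1..M} \<Longrightarrow> l-lipschitz_on X (f n m)"
    and "is_set_attractor (compact_tuples V X) (max_dist V)
           (superifs_indices M N V) (superifs_map M V f) HV"
    and "A \<in> (\<lambda>K. K 1) ` HV"
    and "\<epsilon> > 0"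
  shows "\<exists>(K :: nat \<Rightarrow> 'a set) (r :: nat) (g :: nat \<Rightarrow> 'a \<Rightarrow> 'a) (v :: nat \<Rightarrow> nat).
           (\<forall>i\<in>{1..V}. compact (K i) \<and> K i \<subseteq> X) \<and>
           (\<forall>j\<in>{1..r}. continuous_on X (g j) \<and> g j \<in> X \<rightarrow> X \<and> v j \<in> {1..V}) \<and>
           A = (\<Union>j\<in>{1..r}. g j ` K (v j)) \<and>
           (\<forall>j\<in>{1..r}. diameter (g j ` K (v j)) \<le> \<epsilon>)"
proof -
  \<comment> \<open>A compact subset lies in the carrier of the metric topology; hence components of
    attractor points are compact subsets of \<open>X\<close>.\<close>
  have HV: "HV \<subseteq> compact_tuples V X"
    using assms(9) compactin_subset_topspace
      Metric_space.topspace_mtopology[OF Metric_space_max_dist[OF \<open>V \<ge> 1\<close>]]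
    unfolding is_set_attractor_def by metis
  \<comment> \<open>The depth \<open>k\<close> of unfolding comes from this limit, so it depends
    only on \<open>l\<close>, \<open>diameter X\<close> and \<open>\<epsilon>\<close>.\<close>
  have "(\<lambda>k. l ^ k * diameter X) \<longlonglongrightarrow> 0 * diameter X"
    using assms(5,6) by (intro tendsto_intros) simp
  then have "eventually (\<lambda>k. l ^ k * diameter X < \<epsilon>) sequentially"
    using \<open>\<epsilon> > 0\<close> by (auto dest: order_tendstoD(2))
  then obtain k where k: "l ^ k * diameter X < \<epsilon>"
    by (auto simp: eventually_sequentially)
  obtain H where H: "H \<in> HV" "A = H 1" using assms(10) by auto
  have HV_fix: "HV \<subseteq> (\<Union>a\<in>superifs_indices M N V. superifs_map M V f a ` HV)"
    using assms(9) unfolding is_set_attractor_def by blast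
  obtain K where K: "K \<in> HV" and decomp: "\<forall>v\<in>{1..V}. \<exists>P. finite P \<and>
           (\<forall>(g, w)\<in>P. g \<in> X \<rightarrow> X \<and> (l ^ k)-lipschitz_on X g \<and> w \<in> {1..V}) \<and>
           H v = (\<Union>(g, w)\<in>P. g ` K w)"
    using superifs_iterated_decomposition[OF assms(7,8) HV_fix H(1), of k] by (rule bexE)
  have "1 \<in> {1..V}" using \<open>V \<ge> 1\<close> by simp
  from bspec[OF decomp this] obtain P where fin: "finite P"
    and P: "\<forall>(g, w)\<in>P. g \<in> X \<rightarrow> X \<and> (l ^ k)-lipschitz_on X g \<and> w \<in> {1..V}"
    and A: "A = (\<Union>(g, w)\<in>P. g ` K w)"
    unfolding H(2) by (elim exE conjE)
  have K': "compact (K i) \<and> K i \<subseteq> X" if "i \<in> {1..V}" for i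
    using PiE_mem[OF subsetD[OF HV K, unfolded compact_tuples_def] that]
    by (simp add: nonempty_compacts_def)
  \<comment> \<open>Enumerate the finite set of pairs, with \<open>r = card P\<close>, to pass to
    the indexed form of the conclusion.\<close>
  obtain h where h: "bij_betw h {1..card P} P"
    using ex_bij_betw_nat_finite_1[OF fin] by blast
  then have img: "h ` {1..card P} = P" by (rule bij_betw_imp_surj_on)
  define g where "g = fst \<circ> h"
  define v where "v = snd \<circ> h"
  have gv: "g j \<in> X \<rightarrow> X" "(l ^ k)-lipschitz_on X (g j)" "v j \<in> {1..V}" if "j \<in> {1..card P}" for j
  proof -
    have "h j \<in> P" using that img by blast
    then show "g j \<in> X \<rightarrow> X" "(l ^ k)-lipschitz_on X (g j)" "v j \<in> {1..V}"
      using P by (auto simp: g_def v_def split_def)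
  qed
  have diam: "diameter (g j ` K (v j)) \<le> \<epsilon>" if "j \<in> {1..card P}" for j
  proof -
    have "diameter (g j ` K (v j)) \<le> l ^ k * diameter X"
      using gv(2)[OF that] compact_imp_bounded[OF assms(1)] K'[OF gv(3)[OF that]]
      by (intro diameter_lipschitz_image_le) auto
    then show ?thesis using k by linarith
  qed
  have "A = (\<Union>(g, w)\<in>h ` {1..card P}. g ` K w)"
    by (simp only: A img)
  then have union: "A = (\<Union>j\<in>{1..card P}. g j ` K (v j))"
    by (simp add: g_def v_def split_def)
  have cont: "continuous_on X (g j)" if "j \<in> {1..card P}" for j
    using gv(2)[OF that] by (rule lipschitz_on_continuous_on)
  show ?thesis
    by (intro exI[of _ K] exI[of _ "card P"] exI[of _ g] exI[of _ v] conjI ballI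
        K'[THEN conjunct1] K'[THEN conjunct2] cont gv(1,3) union diam)
qed

end
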